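(* Let $(X,d)$ be a Ptolemaic space, $(Y,\rho)$ a semimetric space, and let $f\colon X\to Y$ be a surjective $\eta$-quasisymmetric mapping. If for all $t_1,t_2,t_3,t_4\in\mathbb{R}^+$ the inequality $$t_1t_2t_3t_4\leqslant t_1t_2+t_3t_4$$ implies $$\eta(t_1)\eta(t_2)\eta(t_3)\eta(t_4)\leqslant \eta(t_1)\eta(t_2)+\eta(t_3)\eta(t_4),$$ then $(Y,\rho)$ is also Ptolemaic.
   Context: $\mathbb{R}^+=[0,\infty)$. A semimetric on a nonempty set $X$ is a function $d\colon X\times X\to\mathbb{R}^+$ with $d(x,y)=0\Leftrightarrow x=y$ and $d(x,y)=d(y,x)$; then $(X,d)$ is a semimetric space. A Ptolemaic space is a semimetric space $(X,d)$ such that $d(x,z)d(t,y)\leqslant d(x,y)d(t,z)+d(x,t)d(y,z)$ for all $x,y,z,t\in X$ (the ordinary triangle inequality is not required). Let $\eta\colon[0,\infty)\to[0,\infty)$ be a homeomorphism. A mapping $f\colon X\to Y$ between semimetric spaces $(X,d)$, $(Y,\rho)$ is $\eta$-quasisymmetric if $d(x,a)\leqslant t\,d(x,b)$ implies $\rho(f(x),f(a))\leqslant\eta(t)\rho(f(x),f(b))$ for all $a,b,x\in X$ and all $t>0$. No continuity of $f$ is assumed. *)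

theory Defs
  imports "HOL-Analysis.Analysis"
begin

definition semimetric_space :: "'a set \<Rightarrow> ('a \<Rightarrow> 'a \<Rightarrow> real) \<Rightarrow> bool" where
  "semimetric_space X d \<longleftrightarrow>
     X \<noteq> {} \<and>
     (\<forall>x\<in>X. \<forall>y\<in>X. 0 \<le> d x y) \<and>
     (\<forall>x\<in>X. \<forall>y\<in>X. d x y = 0 \<longleftrightarrow> x = y) \<and>
     (\<forall>x\<in>X. \<forall>y\<in>X. d x y = d y x)"

definition ptolemaic_space :: "'a set \<Rightarrow> ('a \<Rightarrow> 'a \<Rightarrow> real) \<Rightarrow> bool" where
  "ptolemaic_space X d \<longleftrightarrow>
     semimetric_space X d \<and>
     (\<forall>x\<in>X. \<forall>y\<in>X. \<forall>z\<in>X. \<forall>t\<in>X.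
        d x z * d t y \<le> d x y * d t z + d x t * d y z)"

definition self_homeomorphism_nonneg :: "(real \<Rightarrow> real) \<Rightarrow> bool" where
  "self_homeomorphism_nonneg \<eta> \<longleftrightarrow> (\<exists>\<theta>. homeomorphism {0..} {0..} \<eta> \<theta>)"

text \<open>
  Meant for semimetric spaces \<open>(X, d)\<close> and \<open>(Y, \<rho>)\<close> and a control function \<open>\<eta>\<close>
  that is a homeomorphism of \<open>[0, \<infinity>)\<close>; these standing assumptions are not part of
  the definition.
\<close>
definition quasisymmetric ::
    "(real \<Rightarrow> real) \<Rightarrow> 'a set \<Rightarrow> ('a \<Rightarrow> 'a \<Rightarrow> real) \<Rightarrow> 'b set \<Rightarrow> ('b \<Rightarrow> 'b \<Rightarrow> real) \<Rightarrow>
     ('a \<Rightarrow> 'b) \<Rightarrow> bool" where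
  "quasisymmetric \<eta> X d Y \<rho> f \<longleftrightarrow>
     f \<in> X \<rightarrow> Y \<and>
     (\<forall>a\<in>X. \<forall>b\<in>X. \<forall>x\<in>X. \<forall>t>0.
        d x a \<le> t * d x b \<longrightarrow> \<rho> (f x) (f a) \<le> \<eta> t * \<rho> (f x) (f b))"

end

(* In a semimetric space, Ptolemy's inequality for distinct points says
   1 \<le> 1 / (t1 * t2) + 1 / (t3 * t4), where each ti is a ratio of two distances from a common
   point.  Quasisymmetry bounds the corresponding ratios in the image by the \<eta> ti, so the
   hypothesis on \<eta> carries the inequality over. *)
theory Submission
  imports Defs
begin

lemma semimetric_space_pos:
  assumes "semimetric_space X d" "x \<in> X" "y \<in> X" "x \<noteq> y"
  shows "0 < d x y"
  using assms unfolding semimetric_space_def by (metis less_eq_real_def)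

text \<open>Points with distinct images are distinct, so both distances from \<open>x\<close> are
  positive and the ratio itself may serve as \<open>t\<close>; the premise of quasisymmetry then
  holds with equality.\<close>

lemma quasisymmetric_ratio:
  assumes X: "semimetric_space X d" and Y: "semimetric_space Y \<rho>"
    and qs: "quasisymmetric \<eta> X d Y \<rho> f"
    and mem: "x \<in> X" "a \<in> X" "b \<in> X"
    and ne: "f x \<noteq> f a" "f x \<noteq> f b"
  shows "0 < \<eta> (d x a / d x b)"
    and "\<rho> (f x) (f a) \<le> \<eta> (d x a / d x b) * \<rho> (f x) (f b)"
proof -
  have f: "f \<in> X \<rightarrow> Y"
    using qs by (simp add: quasisymmetric_def)
  have d: "0 < d x a" "0 < d x b"
    using semimetric_space_pos[OF X] mem ne by auto
  have \<rho>: "0 < \<rho> (f x) (f a)" "0 < \<rho> (f x) (f b)"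
    using semimetric_space_pos[OF Y] mem ne f by auto
  show le: "\<rho> (f x) (f a) \<le> \<eta> (d x a / d x b) * \<rho> (f x) (f b)"
    using qs mem d unfolding quasisymmetric_def by simp
  \<comment> \<open>A nonpositive factor would make the right side of \<open>le\<close> nonpositive,
    against the positive left side.\<close>
  show "0 < \<eta> (d x a / d x b)"
    using le \<rho> by (smt (verit) mult_nonpos_nonneg)
qed

text \<open>Both sides of the left inequality carry the positive factor \<open>p / (q * r)\<close>,
  which cancels.\<close>

lemma ptolemaic_ratio_iff:
  fixes p q r :: real
  assumes "0 < p" "0 < q" "0 < r"
  shows "p / q * (p / r) \<le> p / q + p / r \<longleftrightarrow> p \<le> r + q"
proof -
  have "p / q * (p / r) = p / (q * r) * p" "p / q + p / r = p / (q * r) * (r + q)"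
    using assms by (simp_all add: field_simps)
  moreover have "0 < p / (q * r)"
    using assms by simp
  ultimately show ?thesis
    by (simp only: mult_le_cancel_left_pos)
qed

text \<open>Dividing \<open>A * B \<le> A + B\<close> by \<open>A * B\<close> gives
  \<open>1 \<le> 1 / A + 1 / B\<close>, while \<open>p / A \<le> q\<close> and
  \<open>p / B \<le> r\<close>. Upper bounds \<open>A\<close>, \<open>B\<close> on the ratios
  \<open>p / q\<close>, \<open>p / r\<close> thus suffice in this direction.\<close>

lemma ptolemaic_from_ratio_bounds:
  fixes p q r A B :: real
  assumes pos: "0 < A" "0 < B" and le: "p \<le> A * q" "p \<le> B * r"
    and AB: "A * B \<le> A + B" and p: "0 < p"
  shows "p \<le> r + q"
proof -
  have "p / A \<le> q" "p / B \<le> r"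
    using pos le by (simp_all add: field_simps)
  moreover have "p \<le> p / B + p / A"
  proof -
    have "p * (A * B) \<le> p * (A + B)"
      using AB p by simp
    then show ?thesis
      using pos by (simp add: field_simps)
  qed
  ultimately show ?thesis by linarith
qed

theorem proposition3p6:
  fixes X :: "'a set" and d :: "'a \<Rightarrow> 'a \<Rightarrow> real"
    and Y :: "'b set" and \<rho> :: "'b \<Rightarrow> 'b \<Rightarrow> real"
    and \<eta> :: "real \<Rightarrow> real" and f :: "'a \<Rightarrow> 'b"
  assumes "ptolemaic_space X d"
    and "semimetric_space Y \<rho>"
    and "self_homeomorphism_nonneg \<eta>"
    and "quasisymmetric \<eta> X d Y \<rho> f"
    and "f ` X = Y"
    and "\<forall>t1\<ge>0. \<forall>t2\<ge>0. \<forall>t3\<ge>0. \<forall>t4\<ge>0.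
           t1 * t2 * t3 * t4 \<le> t1 * t2 + t3 * t4 \<longrightarrow>
           \<eta> t1 * \<eta> t2 * \<eta> t3 * \<eta> t4 \<le> \<eta> t1 * \<eta> t2 + \<eta> t3 * \<eta> t4"
  shows "ptolemaic_space Y \<rho>"
proof -
  have X: "semimetric_space X d"
    and ptol: "\<And>x y z t. x \<in> X \<Longrightarrow> y \<in> X \<Longrightarrow> z \<in> X \<Longrightarrow> t \<in> X \<Longrightarrow>
      d x z * d t y \<le> d x y * d t z + d x t * d y z"
    using assms(1) unfolding ptolemaic_space_def by auto
  note Y = assms(2)
  have d_sym: "\<And>u v. u \<in> X \<Longrightarrow> v \<in> X \<Longrightarrow> d u v = d v u"
    using X unfolding semimetric_space_def by metis
  have \<rho>_nonneg: "\<And>u v. u \<in> Y \<Longrightarrow> v \<in> Y \<Longrightarrow> 0 \<le> \<rho> u v"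
    and \<rho>_refl: "\<And>u. u \<in> Y \<Longrightarrow> \<rho> u u = 0"
    and \<rho>_sym: "\<And>u v. u \<in> Y \<Longrightarrow> v \<in> Y \<Longrightarrow> \<rho> u v = \<rho> v u"
    using Y unfolding semimetric_space_def by metis+
  have "\<rho> (f x) (f z) * \<rho> (f t) (f y)
      \<le> \<rho> (f x) (f y) * \<rho> (f t) (f z) + \<rho> (f x) (f t) * \<rho> (f y) (f z)"
    if mem: "x \<in> X" "y \<in> X" "z \<in> X" "t \<in> X" for x y z t
  \<comment> \<open>The split is on the images: their distinctness also makes the four points
    distinct, so every ratio below has a positive denominator.\<close>
  proof (cases "distinct [f x, f y, f z, f t]")
    case False
    have fY: "f x \<in> Y" "f y \<in> Y" "f z \<in> Y" "f t \<in> Y"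
      using mem assms(5) by auto
    \<comment> \<open>In the first two cases the left side vanishes; in the other four one summant
      on the right vanishes and the other equals the left side.\<close>
    from False consider "f x = f z" | "f t = f y" | "f x = f y" | "f t = f z" | "f x = f t" | "f y = f z"
      by auto
    then show ?thesis
      by cases (use fY \<rho>_nonneg \<rho>_refl \<rho>_sym in \<open>auto simp: mult.commute\<close>)
  next
    case True
    have fY: "f x \<in> Y" "f y \<in> Y" "f z \<in> Y" "f t \<in> Y"
      using mem assms(5) by auto
    have dpos: "0 < d u v" if "u \<in> X" "v \<in> X" "f u \<noteq> f v" for u v
      using semimetric_space_pos[OF X] that by auto
    have \<rho>pos: "0 < \<rho> (f x) (f z)" "0 < \<rho> (f t) (f y)"
      using semimetric_space_pos[OF Y] fY True by auto
    \<comment> \<open>Each ratio compares distances from one common point, as quasisymmetry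
      requires. The numerators of each pair multiply to the left side of Ptolemy's inequality, the
      denominators to one of the two products on the right.\<close>
    define t1 t2 t3 t4 where
      "t1 = d x z / d x t" and "t2 = d y t / d y z" and
      "t3 = d x z / d x y" and "t4 = d t y / d t z"
    have e1: "0 < \<eta> t1" "\<rho> (f x) (f z) \<le> \<eta> t1 * \<rho> (f x) (f t)"
      unfolding t1_def using quasisymmetric_ratio[OF X Y assms(4)] mem True by auto
    have e2: "0 < \<eta> t2" "\<rho> (f t) (f y) \<le> \<eta> t2 * \<rho> (f y) (f z)"
      unfolding t2_def using quasisymmetric_ratio[OF X Y assms(4), of y t z] mem True
      by (auto simp: \<rho>_sym[OF fY(4) fY(2)])
    have e3: "0 < \<eta> t3" "\<rho> (f x) (f z) \<le> \<eta> t3 * \<rho> (f x) (f y)"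
      unfolding t3_def using quasisymmetric_ratio[OF X Y assms(4)] mem True by auto
    have e4: "0 < \<eta> t4" "\<rho> (f t) (f y) \<le> \<eta> t4 * \<rho> (f t) (f z)"
      unfolding t4_def using quasisymmetric_ratio[OF X Y assms(4), of t y z] mem True by auto
    have pos: "0 < d x z" "0 < d x t" "0 < d y z" "0 < d t y" "0 < d x y" "0 < d t z"
      using dpos mem True by auto
    have ratios: "t1 * t2 = d x z * d t y / (d x t * d y z)" "t3 * t4 = d x z * d t y / (d x y * d t z)"
      unfolding t1_def t2_def t3_def t4_def using mem by (simp_all add: d_sym[of y t])
    have "(t1 * t2) * (t3 * t4) \<le> t1 * t2 + t3 * t4"
      unfolding ratios using pos ptol[OF mem] by (subst ptolemaic_ratio_iff) simp_all
    moreover have "0 \<le> t1" "0 \<le> t2" "0 \<le> t3" "0 \<le> t4"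
      unfolding t1_def t2_def t3_def t4_def using pos d_sym[of y t] mem by simp_all
    ultimately have \<eta>_le: "(\<eta> t1 * \<eta> t2) * (\<eta> t3 * \<eta> t4) \<le> \<eta> t1 * \<eta> t2 + \<eta> t3 * \<eta> t4"
      using assms(6) by (simp add: mult.assoc)
    \<comment> \<open>Multiplying the bounds pairwise yields the inputs of
      \<open>ptolemaic_from_ratio_bounds\<close>, with \<open>A = \<eta> t1 * \<eta> t2\<close> and
      \<open>B = \<eta> t3 * \<eta> t4\<close>.\<close>
    have "\<rho> (f x) (f z) * \<rho> (f t) (f y)
        \<le> (\<eta> t1 * \<eta> t2) * (\<rho> (f x) (f t) * \<rho> (f y) (f z))"
      using mult_mono[OF e1(2) e2(2)] e1 e2 \<rho>pos by (simp add: mult_ac)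
    moreover have "\<rho> (f x) (f z) * \<rho> (f t) (f y)
        \<le> (\<eta> t3 * \<eta> t4) * (\<rho> (f x) (f y) * \<rho> (f t) (f z))"
      using mult_mono[OF e3(2) e4(2)] e3 e4 \<rho>pos by (simp add: mult_ac)
    ultimately show ?thesis
      using ptolemaic_from_ratio_bounds[OF _ _ _ _ \<eta>_le] e1(1) e2(1) e3(1) e4(1) \<rho>pos by simp
  qed
  then show ?thesis
    unfolding ptolemaic_space_def using Y assms(5) by blast
qed

end
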